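(* Let $(X,\mathcal{T})$ be a topological space and let $\mathcal{T}^{\alpha}$ be the topology on $X$ consisting of all $\alpha$-sets of $(X,\mathcal{T})$. Then: (a) $(X,\mathcal{T}^{\alpha})$ is semi-compact if and only if $(X,\mathcal{T})$ is semi-compact. (b) $(X,\mathcal{T}^{\alpha})$ is $S$-closed if and only if $(X,\mathcal{T})$ is $S$-closed. (c) $(X,\mathcal{T}^{\alpha})$ is $s$-closed if and only if $(X,\mathcal{T})$ is $s$-closed. (d) $(X,\mathcal{T}^{\alpha})$ is $rc$-Lindelöf if and only if $(X,\mathcal{T})$ is $rc$-Lindelöf. (e) $(X,\mathcal{T}^{\alpha})$ is sg-compact if and only if $(X,\mathcal{T})$ is sg-compact.
   Context: No separation axioms are assumed. Let $(X,\mathcal{T})$ be a topological space and $A\subseteq X$, with interior $\mathrm{Int}\,A$ and closure $\mathrm{Cl}\,A$. The set $A$ is semi-open if $A\subseteq \mathrm{Cl}(\mathrm{Int}\,A)$; regular open if $A=\mathrm{Int}(\mathrm{Cl}\,A)$; an $\alpha$-set (or $\alpha$-open) if $A\subseteq \mathrm{Int}(\mathrm{Cl}(\mathrm{Int}\,A))$. It is semi-closed (resp. regular closed) if its complement is semi-open (resp. regular open). The collection $\mathcal{T}^{\alpha}$ of all $\alpha$-sets of $(X,\mathcal{T})$ is a topology on $X$ finer than $\mathcal{T}$ (Njåstad). The semi-closure $\mathrm{sCl}\,A$ is the intersection of all semi-closed sets containing $A$; the semi-interior of $A$ is the union of all semi-open sets contained in $A$. The set $A$ is sg-open if every semi-closed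 subset of $A$ is contained in the semi-interior of $A$. A topological space is: semi-compact if every cover of it by semi-open sets has a finite subcover; $S$-closed (resp. $s$-closed) if for every cover of it by semi-open sets there is a finite subfamily whose closures (resp. semi-closures) cover the space; $rc$-Lindelöf if every cover of it by regular closed sets has a countable subcover; sg-compact if every cover of it by sg-open sets has a finite subcover. For each of the two spaces all notions (semi-open, closure, etc.) are taken with respect to that space's own topology. *)

theory Defs
  imports "HOL-Analysis.Analysis"
begin

text \<open>
  A space is a value \<open>X :: 'a topology\<close> with carrier \<^term>\<open>topspace X\<close>, which may be empty.
  The operators \<^const>\<open>closure_of\<close> and \<^const>\<open>interior_of\<close> always return subsets of the carrier,
  so semi-open, regular open and alpha-open sets are automatically subsets of it; the other
  notions state this explicitly.
\<close>

definition semi_open :: "'a topology \<Rightarrow> 'a set \<Rightarrow> bool" where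
  "semi_open X A \<longleftrightarrow> A \<subseteq> X closure_of (X interior_of A)"

definition semi_closed :: "'a topology \<Rightarrow> 'a set \<Rightarrow> bool" where
  "semi_closed X A \<longleftrightarrow> A \<subseteq> topspace X \<and> semi_open X (topspace X - A)"

definition regular_open :: "'a topology \<Rightarrow> 'a set \<Rightarrow> bool" where
  "regular_open X A \<longleftrightarrow> A = X interior_of (X closure_of A)"

definition regular_closed :: "'a topology \<Rightarrow> 'a set \<Rightarrow> bool" where
  "regular_closed X A \<longleftrightarrow> A \<subseteq> topspace X \<and> regular_open X (topspace X - A)"

definition alpha_open :: "'a topology \<Rightarrow> 'a set \<Rightarrow> bool" where
  "alpha_open X A \<longleftrightarrow> A \<subseteq> X interior_of (X closure_of (X interior_of A))"

definition semi_closure :: "'a topology \<Rightarrow> 'a set \<Rightarrow> 'a set" where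
  "semi_closure X A = \<Inter>{F. semi_closed X F \<and> A \<subseteq> F}"

definition semi_interior :: "'a topology \<Rightarrow> 'a set \<Rightarrow> 'a set" where
  "semi_interior X A = \<Union>{U. semi_open X U \<and> U \<subseteq> A}"

definition sg_open :: "'a topology \<Rightarrow> 'a set \<Rightarrow> bool" where
  "sg_open X A \<longleftrightarrow>
    A \<subseteq> topspace X \<and> (\<forall>F. semi_closed X F \<and> F \<subseteq> A \<longrightarrow> F \<subseteq> semi_interior X A)"

definition alpha_topology :: "'a topology \<Rightarrow> 'a topology" where
  "alpha_topology X = topology (alpha_open X)"

lemma istopology_alpha_open: "istopology (alpha_open X)"
  unfolding istopology_def
proof (intro conjI allI impI)
  fix A B
  assume A: "alpha_open X A" and B: "alpha_open X B"
  define U V where "U = X interior_of A" and "V = X interior_of B"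
  define P Q where "P = X interior_of (X closure_of U)" and "Q = X interior_of (X closure_of V)"
  have U: "openin X U" and P: "openin X P" and Q: "openin X Q"
    by (simp_all add: U_def P_def Q_def)
  have PU: "P \<subseteq> X closure_of U" and QV: "Q \<subseteq> X closure_of V"
    by (simp_all add: P_def Q_def interior_of_subset)
  have "P \<inter> Q \<subseteq> Q \<inter> X closure_of U"
    using PU by blast
  also have "\<dots> \<subseteq> X closure_of (Q \<inter> U)"
    by (rule openin_Int_closure_of_subset[OF Q])
  also have "\<dots> \<subseteq> X closure_of (U \<inter> X closure_of V)"
    using QV by (intro closure_of_mono) blast
  also have "\<dots> \<subseteq> X closure_of (X closure_of (U \<inter> V))"
    by (intro closure_of_mono openin_Int_closure_of_subset[OF U])
  finally have "P \<inter> Q \<subseteq> X closure_of (U \<inter> V)"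
    by simp
  then have "P \<inter> Q \<subseteq> X interior_of (X closure_of (U \<inter> V))"
    using P Q by (intro interior_of_maximal) auto
  moreover have "A \<subseteq> P" "B \<subseteq> Q"
    using A B by (auto simp: alpha_open_def P_def Q_def U_def V_def)
  moreover have "U \<inter> V = X interior_of (A \<inter> B)"
    by (simp add: U_def V_def interior_of_Int)
  ultimately show "alpha_open X (A \<inter> B)"
    unfolding alpha_open_def by force
next
  fix K
  assume K: "\<forall>A\<in>K. alpha_open X A"
  show "alpha_open X (\<Union>K)"
    unfolding alpha_open_def
  proof (rule Union_least)
    fix A
    assume "A \<in> K"
    then have "A \<subseteq> X interior_of (X closure_of (X interior_of A))"
      using K by (simp add: alpha_open_def)
    also have "\<dots> \<subseteq> X interior_of (X closure_of (X interior_of (\<Union>K)))"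
      using \<open>A \<in> K\<close> by (intro interior_of_mono closure_of_mono) blast
    finally show "A \<subseteq> X interior_of (X closure_of (X interior_of (\<Union>K)))" .
  qed
qed

lemma openin_alpha_topology: "openin (alpha_topology X) A \<longleftrightarrow> alpha_open X A"
  by (simp add: alpha_topology_def istopology_alpha_open)

lemma alpha_open_if_openin: "openin X A \<Longrightarrow> alpha_open X A"
  by (simp add: alpha_open_def interior_of_openin interior_of_maximal closure_of_subset openin_subset)

lemma topspace_alpha_topology: "topspace (alpha_topology X) = topspace X"
proof
  have "A \<subseteq> topspace X" if "alpha_open X A" for A
    using that interior_of_subset_topspace unfolding alpha_open_def by (metis order_trans)
  then show "topspace (alpha_topology X) \<subseteq> topspace X"
    using openin_alpha_topology openin_topspace by blast
  show "topspace X \<subseteq> topspace (alpha_topology X)"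
    by (simp add: openin_subset openin_alpha_topology alpha_open_if_openin)
qed

definition semi_compact_space :: "'a topology \<Rightarrow> bool" where
  "semi_compact_space X \<longleftrightarrow>
    (\<forall>\<U>. (\<forall>U\<in>\<U>. semi_open X U) \<and> topspace X \<subseteq> \<Union>\<U> \<longrightarrow>
      (\<exists>\<F>. finite \<F> \<and> \<F> \<subseteq> \<U> \<and> topspace X \<subseteq> \<Union>\<F>))"

text \<open>The next two notions differ only in closure versus semi-closure; they are named
  \<open>S\<close>-closed and \<open>s\<close>-closed in the literature.\<close>

definition S_closed_space :: "'a topology \<Rightarrow> bool" where
  "S_closed_space X \<longleftrightarrow>
    (\<forall>\<U>. (\<forall>U\<in>\<U>. semi_open X U) \<and> topspace X \<subseteq> \<Union>\<U> \<longrightarrow>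
      (\<exists>\<F>. finite \<F> \<and> \<F> \<subseteq> \<U> \<and> topspace X \<subseteq> (\<Union>U\<in>\<F>. X closure_of U)))"

definition s_closed_space :: "'a topology \<Rightarrow> bool" where
  "s_closed_space X \<longleftrightarrow>
    (\<forall>\<U>. (\<forall>U\<in>\<U>. semi_open X U) \<and> topspace X \<subseteq> \<Union>\<U> \<longrightarrow>
      (\<exists>\<F>. finite \<F> \<and> \<F> \<subseteq> \<U> \<and> topspace X \<subseteq> (\<Union>U\<in>\<F>. semi_closure X U)))"

definition rc_Lindelof_space :: "'a topology \<Rightarrow> bool" where
  "rc_Lindelof_space X \<longleftrightarrow>
    (\<forall>\<U>. (\<forall>U\<in>\<U>. regular_closed X U) \<and> topspace X \<subseteq> \<Union>\<U> \<longrightarrow>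
      (\<exists>\<F>. countable \<F> \<and> \<F> \<subseteq> \<U> \<and> topspace X \<subseteq> \<Union>\<F>))"

definition sg_compact_space :: "'a topology \<Rightarrow> bool" where
  "sg_compact_space X \<longleftrightarrow>
    (\<forall>\<U>. (\<forall>U\<in>\<U>. sg_open X U) \<and> topspace X \<subseteq> \<Union>\<U> \<longrightarrow>
      (\<exists>\<F>. finite \<F> \<and> \<F> \<subseteq> \<U> \<and> topspace X \<subseteq> \<Union>\<F>))"

end

theory Submission
  imports Defs
begin

text \<open>
  All five covering properties speak only of semi-open sets, of what is defined from them
  (semi-closed and sg-open sets, semi-closure, semi-interior), of regular closed sets, and of
  closures of semi-open sets. None of these can distinguish \<open>X\<close> from its topology of alpha-sets,
  so each property says literally the same thing in both spaces.

  The alpha-topology is finer, so a priori closures shrink and interiors grow. The point is that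
  an alpha-neighbourhood \<open>V\<close> of a point lies in the open set \<open>Int (Cl (Int V))\<close>, in which the open
  set \<open>Int V\<close> is dense. Hence, if the point is in the closure of a semi-open set \<open>A\<close>, then \<open>V\<close>
  itself meets \<open>Int A\<close>, because \<open>Int A\<close> is dense in \<open>A\<close>: passing to the alpha-topology does not
  shrink the closure of a semi-open set (\<open>closure_of_alpha_topology\<close>). Applied to \<open>Int A\<close> this keeps
  semi-open sets semi-open. Nor do new ones arise, since an alpha-open set is already semi-open
  in \<open>X\<close> (\<open>semi_open_alpha_topology\<close>). Finally, the regular closed sets are the semi-open sets
  that equal their closure, so they agree as well.
\<close>

lemma interior_of_subset_alpha_interior:
  "X interior_of A \<subseteq> (alpha_topology X) interior_of A"
  by (simp add: interior_of_maximal interior_of_subset openin_alpha_topology alpha_open_if_openin)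

lemma alpha_closure_subset_closure_of:
  "(alpha_topology X) closure_of A \<subseteq> X closure_of A"
  unfolding in_closure_of subset_iff topspace_alpha_topology openin_alpha_topology
  by (meson alpha_open_if_openin)

lemma semi_open_interior_of_dense:
  assumes "semi_open X A"
  shows "X closure_of (X interior_of A) = X closure_of A"
proof
  show "X closure_of (X interior_of A) \<subseteq> X closure_of A"
    by (intro closure_of_mono interior_of_subset)
  show "X closure_of A \<subseteq> X closure_of (X interior_of A)"
    using assms by (simp add: semi_open_def closure_of_minimal)
qed

lemma semi_open_if_alpha_open: "alpha_open X A \<Longrightarrow> semi_open X A"
  unfolding alpha_open_def semi_open_def by (rule order_trans[OF _ interior_of_subset])

text \<open>
  Semi-openness allows \<open>A\<close> to be replaced by its interior, and an open set that meets the closure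
  of another meets that set itself. For arbitrary sets the two closures differ: in a space with
  three points whose only proper nonempty open set is a singleton \<open>{p}\<close>, each of the other points
  is alpha-closed but has the other one in its closure.
\<close>
lemma closure_of_alpha_topology:
  assumes "semi_open X A"
  shows "(alpha_topology X) closure_of A = X closure_of A"
proof
  show "(alpha_topology X) closure_of A \<subseteq> X closure_of A"
    by (rule alpha_closure_subset_closure_of)
  show "X closure_of A \<subseteq> (alpha_topology X) closure_of A"
  proof
    fix x assume "x \<in> X closure_of A"
    then have x: "x \<in> X closure_of (X interior_of A)"
      by (simp add: semi_open_interior_of_dense[OF assms])
    have "\<exists>y. y \<in> A \<and> y \<in> V" if "x \<in> V" "alpha_open X V" for V
    proof -
      let ?W = "X interior_of (X closure_of (X interior_of V))"
      have "x \<in> ?W"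
        using that by (auto simp: alpha_open_def)
      then obtain y where y: "y \<in> X interior_of A" "y \<in> ?W"
        using x by (meson in_closure_of openin_interior_of)
      then have "y \<in> X closure_of (X interior_of V)"
        using interior_of_subset by (meson subsetD)
      then obtain z where "z \<in> X interior_of V" "z \<in> X interior_of A"
        using y(1) by (meson in_closure_of openin_interior_of)
      then show ?thesis
        by (meson interior_of_subset subsetD)
    qed
    moreover have "x \<in> topspace X"
      using x by (simp add: in_closure_of)
    ultimately show "x \<in> (alpha_topology X) closure_of A"
      by (simp add: in_closure_of topspace_alpha_topology openin_alpha_topology)
  qed
qed

lemma semi_open_alpha_topology: "semi_open (alpha_topology X) = semi_open X"
proof (intro ext iffI)
  fix A assume A: "semi_open X A"
  have "semi_open X (X interior_of A)"
    by (simp add: semi_open_if_alpha_open alpha_open_if_openin)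
  then have "A \<subseteq> (alpha_topology X) closure_of (X interior_of A)"
    using A by (simp add: closure_of_alpha_topology semi_open_def)
  also have "\<dots> \<subseteq> (alpha_topology X) closure_of ((alpha_topology X) interior_of A)"
    by (intro closure_of_mono interior_of_subset_alpha_interior)
  finally show "semi_open (alpha_topology X) A"
    by (simp add: semi_open_def)
next
  fix A assume A: "semi_open (alpha_topology X) A"
  let ?I = "(alpha_topology X) interior_of A"
  have "semi_open X ?I"
    by (metis openin_interior_of openin_alpha_topology semi_open_if_alpha_open)
  have "A \<subseteq> (alpha_topology X) closure_of ?I"
    using A by (simp add: semi_open_def)
  also have "\<dots> = X closure_of ?I"
    using \<open>semi_open X ?I\<close> by (rule closure_of_alpha_topology)
  also have "\<dots> = X closure_of (X interior_of ?I)"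
    using \<open>semi_open X ?I\<close> by (simp only: semi_open_interior_of_dense)
  also have "\<dots> \<subseteq> X closure_of (X interior_of A)"
    by (intro closure_of_mono interior_of_mono interior_of_subset)
  finally show "semi_open X A"
    by (simp add: semi_open_def)
qed

lemma semi_closed_alpha_topology: "semi_closed (alpha_topology X) = semi_closed X"
  by (simp add: fun_eq_iff semi_closed_def semi_open_alpha_topology topspace_alpha_topology)

lemma semi_closure_alpha_topology: "semi_closure (alpha_topology X) = semi_closure X"
  by (simp add: fun_eq_iff semi_closure_def semi_closed_alpha_topology)

lemma sg_open_alpha_topology: "sg_open (alpha_topology X) = sg_open X"
  by (simp add: fun_eq_iff sg_open_def semi_interior_def semi_closed_alpha_topology
      semi_open_alpha_topology topspace_alpha_topology)

text \<open>
  This form of regular closedness involves only what the alpha-topology preserves: semi-openness,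
  and the closure of a semi-open set.
\<close>
lemma regular_closed_iff_semi_open_closure:
  "regular_closed X A \<longleftrightarrow> semi_open X A \<and> X closure_of A = A"
proof -
  have "regular_closed X A \<longleftrightarrow> A = X closure_of (X interior_of A)"
  proof -
    have "X interior_of (X closure_of (topspace X - A))
        = topspace X - X closure_of (X interior_of A)"
      by (simp add: closure_of_complement interior_of_complement)
    then show ?thesis
      unfolding regular_closed_def regular_open_def
      using closure_of_subset_topspace[of X "X interior_of A"] by auto
  qed
  also have "\<dots> \<longleftrightarrow> semi_open X A \<and> X closure_of A = A"
    by (metis closure_of_closure_of semi_open_interior_of_dense semi_open_def order_refl)
  finally show ?thesis .
qed

lemma regular_closed_alpha_topology: "regular_closed (alpha_topology X) = regular_closed X"
  by (auto simp: fun_eq_iff regular_closed_iff_semi_open_closure semi_open_alpha_topology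
      closure_of_alpha_topology)

theorem theorem2p5:
  fixes X :: "'a topology"
  shows "(semi_compact_space (alpha_topology X) \<longleftrightarrow> semi_compact_space X) \<and>
    (S_closed_space (alpha_topology X) \<longleftrightarrow> S_closed_space X) \<and>
    (s_closed_space (alpha_topology X) \<longleftrightarrow> s_closed_space X) \<and>
    (rc_Lindelof_space (alpha_topology X) \<longleftrightarrow> rc_Lindelof_space X) \<and>
    (sg_compact_space (alpha_topology X) \<longleftrightarrow> sg_compact_space X)"
proof (intro conjI)
  show "semi_compact_space (alpha_topology X) \<longleftrightarrow> semi_compact_space X"
    by (simp add: semi_compact_space_def semi_open_alpha_topology topspace_alpha_topology)
  have "(\<Union>U\<in>\<F>. (alpha_topology X) closure_of U) = (\<Union>U\<in>\<F>. X closure_of U)"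
    if "\<forall>U\<in>\<U>. semi_open X U" "\<F> \<subseteq> \<U>" for \<U> \<F>
    using that by (intro SUP_cong refl closure_of_alpha_topology) blast
  then have "(\<exists>\<F>. finite \<F> \<and> \<F> \<subseteq> \<U> \<and> topspace X \<subseteq> (\<Union>U\<in>\<F>. (alpha_topology X) closure_of U))
      \<longleftrightarrow> (\<exists>\<F>. finite \<F> \<and> \<F> \<subseteq> \<U> \<and> topspace X \<subseteq> (\<Union>U\<in>\<F>. X closure_of U))"
    if "\<forall>U\<in>\<U>. semi_open X U" for \<U>
    using that by (metis (no_types, lifting))
  then show "S_closed_space (alpha_topology X) \<longleftrightarrow> S_closed_space X"
    by (simp add: S_closed_space_def semi_open_alpha_topology topspace_alpha_topology
        cong: imp_cong)
  show "s_closed_space (alpha_topology X) \<longleftrightarrow> s_closed_space X"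
    by (simp add: s_closed_space_def semi_open_alpha_topology semi_closure_alpha_topology
        topspace_alpha_topology)
  show "rc_Lindelof_space (alpha_topology X) \<longleftrightarrow> rc_Lindelof_space X"
    by (simp add: rc_Lindelof_space_def regular_closed_alpha_topology topspace_alpha_topology)
  show "sg_compact_space (alpha_topology X) \<longleftrightarrow> sg_compact_space X"
    by (simp add: sg_compact_space_def sg_open_alpha_topology topspace_alpha_topology)
qed

end
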